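(* Let $p$ be a prime and $n>1$ an integer. If $G$ is a finite $p$-group with $G\in\mathcal{D}_n$, then $G$ has nilpotency class at most $n/2$ and derived length at most $\log_2(n/2)+1$.
   Context: $\mathcal{D}(G)$ denotes the number of conjugacy classes of nontrivial subgroups $H$ of the finite group $G$ with $N_G(H)\neq H$; $\mathcal{D}_n$ is the family of finite groups $G$ with $\mathcal{D}(G)=n$. *)

theory Defs
  imports "HOL-Algebra.Algebra"
begin

definition subgroup_conj_class :: "('a, 'b) monoid_scheme \<Rightarrow> 'a set \<Rightarrow> 'a set set" where
  "subgroup_conj_class G H = {g <#\<^bsub>G\<^esub> H #>\<^bsub>G\<^esub> inv\<^bsub>G\<^esub> g | g. g \<in> carrier G}"

definition D_count :: "('a, 'b) monoid_scheme \<Rightarrow> nat" where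
  "D_count G = card {subgroup_conj_class G H | H.
      subgroup H G \<and> H \<noteq> {\<one>\<^bsub>G\<^esub>} \<and> normalizer G H \<noteq> H}"

definition comm_subgroup :: "('a, 'b) monoid_scheme \<Rightarrow> 'a set \<Rightarrow> 'a set \<Rightarrow> 'a set" where
  "comm_subgroup G A B = generate G
     {a \<otimes>\<^bsub>G\<^esub> b \<otimes>\<^bsub>G\<^esub> inv\<^bsub>G\<^esub> a \<otimes>\<^bsub>G\<^esub> inv\<^bsub>G\<^esub> b | a b. a \<in> A \<and> b \<in> B}"

text \<open>Lower central series, indexed from 0: lower_central G 0 = G = gamma_1,
  lower_central G (i+1) = [lower_central G i, G] = gamma_(i+2).\<close>
fun lower_central :: "('a, 'b) monoid_scheme \<Rightarrow> nat \<Rightarrow> 'a set" where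
  "lower_central G 0 = carrier G"
| "lower_central G (Suc i) = comm_subgroup G (lower_central G i) (carrier G)"

definition nilpotency_class :: "('a, 'b) monoid_scheme \<Rightarrow> nat" where
  "nilpotency_class G = (LEAST c. lower_central G c = {\<one>\<^bsub>G\<^esub>})"

definition derived_length :: "('a, 'b) monoid_scheme \<Rightarrow> nat" where
  "derived_length G = (LEAST d. (derived G ^^ d) (carrier G) = {\<one>\<^bsub>G\<^esub>})"

definition p_group :: "nat \<Rightarrow> ('a, 'b) monoid_scheme \<Rightarrow> bool" where
  "p_group p G \<longleftrightarrow> group G \<and> finite (carrier G) \<and> (\<exists>k. card (carrier G) = p ^ k)"

end

theory Submission
  imports Defs
begin

text \<open>
  A finite \<open>p\<close>-group is nilpotent, so that every proper subgroup differs from its normalizer and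
  \<open>D_count\<close> counts the conjugacy classes of all nontrivial proper subgroups. Let
  \<open>\<gamma>\<^sub>1 > \<dots> > \<gamma>\<^sub>c > \<gamma>\<^sub>c\<^sub>+\<^sub>1 = 1\<close> be the lower central series, with \<open>c \<ge> 2\<close>. As \<open>G / \<gamma>\<^sub>2\<close> is not cyclic
  and no group is the union of two proper subgroups, at least four proper subgroups contain \<open>\<gamma>\<^sub>2\<close>, all
  of them normal. For \<open>2 \<le> i < c\<close> there are at least two further classes of subgroups containing
  \<open>\<gamma>\<^sub>i\<^sub>+\<^sub>1\<close> but not \<open>\<gamma>\<^sub>i\<close>, namely those of \<open>\<gamma>\<^sub>i\<^sub>+\<^sub>1\<close> and of \<open>\<langle>x\<rangle> \<gamma>\<^sub>i\<^sub>+\<^sub>1\<close> for some \<open>x\<close> that does not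
  centralize \<open>\<gamma>\<^sub>i / \<gamma>\<^sub>i\<^sub>+\<^sub>2\<close>. Altogether there are \<open>2 c\<close> classes. The derived length is bounded by the
  class, as the \<open>d\<close>-th derived subgroup is contained in \<open>\<gamma>\<^bsub>2^d\<^esub>\<close>.
\<close>

section \<open>Commutators\<close>

context group
begin

abbreviation commutator :: "'a \<Rightarrow> 'a \<Rightarrow> 'a"
  where "commutator x y \<equiv> x \<otimes> y \<otimes> inv x \<otimes> inv y"

lemma inv_mult_cancel [simp]:
  assumes "x \<in> carrier G" "y \<in> carrier G"
  shows "inv x \<otimes> (x \<otimes> y) = y" "x \<otimes> (inv x \<otimes> y) = y"
  using assms by (simp_all flip: m_assoc)

lemma inv_commutator:
  assumes "x \<in> carrier G" "y \<in> carrier G"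
  shows "inv (commutator x y) = commutator y x"
  using assms by (simp add: m_assoc inv_mult_group)

lemma commutator_swap_mem:
  assumes "subgroup N G" "x \<in> carrier G" "y \<in> carrier G" "commutator x y \<in> N"
  shows "commutator y x \<in> N"
  using assms subgroup.m_inv_closed inv_commutator by metis

text \<open>The Hall--Witt identity, solved for one of its three double commutators.\<close>

lemma hall_witt:
  assumes "x \<in> carrier G" "y \<in> carrier G" "z \<in> carrier G"
  shows "commutator (commutator x y) z
    = x \<otimes> inv ((z \<otimes> commutator (commutator (inv z) (inv x)) y \<otimes> inv z)
        \<otimes> (y \<otimes> commutator (commutator (inv y) z) (inv x) \<otimes> inv y)) \<otimes> inv x"
  using assms by (simp add: m_assoc inv_mult_group)

lemma double_commutator_mem:
  assumes N: "N \<lhd> G" and xyz: "x \<in> carrier G" "y \<in> carrier G" "z \<in> carrier G"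
    and zxy: "commutator (commutator (inv z) (inv x)) y \<in> N"
    and yzx: "commutator (commutator (inv y) z) (inv x) \<in> N"
  shows "commutator (commutator x y) z \<in> N"
proof -
  interpret N: normal N G by fact
  note conjugates = N.inv_op_closed2[OF xyz(3) zxy] N.inv_op_closed2[OF xyz(2) yzx]
  show ?thesis
    unfolding hall_witt[OF xyz]
    by (rule N.inv_op_closed2[OF xyz(1) N.m_inv_closed[OF N.m_closed[OF conjugates]]])
qed

definition centralizer_mod :: "'a set \<Rightarrow> 'a set \<Rightarrow> 'a set"
  where "centralizer_mod N B = {x \<in> carrier G. \<forall>b\<in>B. commutator x b \<in> N}"

lemma centralizer_mod_subset: "centralizer_mod N B \<subseteq> carrier G"
  by (auto simp: centralizer_mod_def)

lemma centralizer_mod_antimono: "A \<subseteq> B \<Longrightarrow> centralizer_mod N B \<subseteq> centralizer_mod N A"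
  by (auto simp: centralizer_mod_def)

lemma subgroup_centralizer_mod:
  assumes N: "N \<lhd> G" and B: "B \<subseteq> carrier G"
  shows "subgroup (centralizer_mod N B) G"
proof
  interpret N: normal N G by fact
  show "centralizer_mod N B \<subseteq> carrier G" by (rule centralizer_mod_subset)
  show "\<one> \<in> centralizer_mod N B" using B by (auto simp: centralizer_mod_def)
  fix x assume x: "x \<in> centralizer_mod N B"
  then have xG: "x \<in> carrier G" by (simp add: centralizer_mod_def)
  have "commutator (inv x) b \<in> N" if b: "b \<in> B" for b
  proof -
    have bG: "b \<in> carrier G" using b B by auto
    have "commutator b x \<in> N"
      using x b commutator_swap_mem[OF N.subgroup_axioms xG bG] by (auto simp: centralizer_mod_def)
    then have "inv x \<otimes> commutator b x \<otimes> x \<in> N" by (rule N.inv_op_closed1[OF xG])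
    then show ?thesis using xG bG by (simp add: m_assoc)
  qed
  then show "inv x \<in> centralizer_mod N B" using xG by (simp add: centralizer_mod_def)
  fix y assume y: "y \<in> centralizer_mod N B"
  then have yG: "y \<in> carrier G" by (simp add: centralizer_mod_def)
  have "commutator (x \<otimes> y) b \<in> N" if b: "b \<in> B" for b
  proof -
    have bG: "b \<in> carrier G" using b B by auto
    have "(x \<otimes> commutator y b \<otimes> inv x) \<otimes> commutator x b \<in> N"
      by (rule N.m_closed[OF N.inv_op_closed2[OF xG]]) (use x y b in \<open>auto simp: centralizer_mod_def\<close>)
    then show ?thesis using xG yG bG by (simp add: m_assoc inv_mult_group)
  qed
  then show "x \<otimes> y \<in> centralizer_mod N B" using xG yG by (simp add: centralizer_mod_def)
qed

lemma normal_subset_centralizer_mod: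
  assumes N: "N \<lhd> G" and B: "B \<subseteq> carrier G"
  shows "N \<subseteq> centralizer_mod N B"
proof
  interpret N: normal N G by fact
  fix x assume x: "x \<in> N"
  have "commutator x b \<in> N" if "b \<in> B" for b
  proof -
    have b: "b \<in> carrier G" using that B by blast
    have "x \<otimes> (b \<otimes> inv x \<otimes> inv b) \<in> N"
      using N.m_closed[OF x N.inv_op_closed2[OF b N.m_inv_closed[OF x]]] .
    then show ?thesis using x b by (simp add: m_assoc)
  qed
  then show "x \<in> centralizer_mod N B" using x by (simp add: centralizer_mod_def)
qed

lemma normal_if_between_centralizer_mod:
  assumes H: "subgroup H G" and "N \<subseteq> H" and "H \<subseteq> centralizer_mod N (carrier G)"
  shows "H \<lhd> G"
proof (rule normal_invI[OF H])
  fix g h assume g: "g \<in> carrier G" and h: "h \<in> H"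
  have hG: "h \<in> carrier G" using H h by (rule subgroup.mem_carrier)
  have "commutator h g \<in> H" using assms g h by (auto simp: centralizer_mod_def)
  then have "commutator g h \<in> H" by (rule commutator_swap_mem[OF H hG g])
  then have "commutator g h \<otimes> h \<in> H" using H h by (simp add: subgroup.m_closed)
  then show "g \<otimes> h \<otimes> inv g \<in> H" using g hG by (simp add: m_assoc)
qed

lemma normal_centralizer_mod:
  assumes "N \<lhd> G" shows "centralizer_mod N (carrier G) \<lhd> G"
  using assms subgroup_centralizer_mod normal_subset_centralizer_mod
  by (intro normal_if_between_centralizer_mod[where N = N]) auto

lemma generate_insert_subset_centralizer_mod:
  assumes N: "N \<lhd> G" and x: "x \<in> carrier G" and K: "K \<subseteq> centralizer_mod N (carrier G)"
  shows "generate G (insert x K) \<subseteq> centralizer_mod N {x}"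
proof (rule generate_subgroup_incl)
  have "\<one> \<in> N" using normal_imp_subgroup[OF N] by (rule subgroup.one_closed)
  then have "x \<in> centralizer_mod N {x}" using x by (simp add: centralizer_mod_def m_assoc)
  then show "insert x K \<subseteq> centralizer_mod N {x}"
    using K x centralizer_mod_antimono[of "{x}" "carrier G"] by auto
  show "subgroup (centralizer_mod N {x}) G" using N x by (simp add: subgroup_centralizer_mod)
qed

text \<open>For \<open>N = 1\<close>: a group with a cyclic central quotient is abelian.\<close>

lemma centralizer_mod_eq_carrier_if_generate:
  assumes N: "N \<lhd> G" and x: "x \<in> carrier G" and K: "K \<subseteq> centralizer_mod N (carrier G)"
    and gen: "generate G (insert x K) = carrier G"
  shows "centralizer_mod N (carrier G) = carrier G"
proof
  have "carrier G \<subseteq> centralizer_mod N {x}"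
    using generate_insert_subset_centralizer_mod[OF N x K] gen by simp
  then have "commutator g x \<in> N" if "g \<in> carrier G" for g
    using that by (auto simp: centralizer_mod_def)
  then have "commutator x g \<in> N" if "g \<in> carrier G" for g
    using that commutator_swap_mem[OF normal_imp_subgroup[OF N] that x] by blast
  then have "insert x K \<subseteq> centralizer_mod N (carrier G)"
    using K x by (auto simp: centralizer_mod_def)
  then have "generate G (insert x K) \<subseteq> centralizer_mod N (carrier G)"
    using N by (intro generate_subgroup_incl subgroup_centralizer_mod subset_refl)
  then show "carrier G \<subseteq> centralizer_mod N (carrier G)" by (simp only: gen)
qed (rule centralizer_mod_subset)

lemma ex_subgroup_psupset_not_supset:
  assumes N: "N \<lhd> G" and "K \<subseteq> centralizer_mod N (carrier G)"
    and "M \<subseteq> carrier G" and "\<not> M \<subseteq> centralizer_mod N (carrier G)"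
  obtains H where "subgroup H G" "K \<subset> H" "\<not> M \<subseteq> H"
proof -
  obtain a x where a: "a \<in> M" and x: "x \<in> carrier G" and "commutator a x \<notin> N"
    using assms(3,4) by (auto simp: centralizer_mod_def)
  moreover have "a \<in> carrier G" using a assms(3) by blast
  ultimately have "commutator x a \<notin> N"
    using commutator_swap_mem[OF normal_imp_subgroup[OF N] x] by blast
  let ?H = "generate G (insert x K)"
  have KG: "insert x K \<subseteq> carrier G" using assms(2) x centralizer_mod_subset by blast
  have "a \<notin> ?H"
    using generate_insert_subset_centralizer_mod[OF N x assms(2)] \<open>commutator a x \<notin> N\<close>
    by (auto simp: centralizer_mod_def)
  moreover have "x \<notin> K"
    using assms(2) \<open>a \<in> carrier G\<close> \<open>commutator x a \<notin> N\<close> by (auto simp: centralizer_mod_def)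
  then have "K \<subset> ?H" by (auto intro: generate.incl)
  ultimately show thesis using that[OF generate_is_subgroup[OF KG]] a by blast
qed

section \<open>The lower central series\<close>

lemma commutator_mem_comm_subgroup:
  "a \<in> A \<Longrightarrow> b \<in> B \<Longrightarrow> commutator a b \<in> comm_subgroup G A B"
  unfolding comm_subgroup_def by (blast intro: generate.incl)

lemma comm_subgroup_subset_iff:
  assumes "A \<subseteq> carrier G" "subgroup N G"
  shows "comm_subgroup G A B \<subseteq> N \<longleftrightarrow> A \<subseteq> centralizer_mod N B"
proof
  assume "comm_subgroup G A B \<subseteq> N"
  then show "A \<subseteq> centralizer_mod N B"
    using assms(1) commutator_mem_comm_subgroup unfolding centralizer_mod_def by blast
next
  assume "A \<subseteq> centralizer_mod N B"
  then show "comm_subgroup G A B \<subseteq> N"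
    unfolding comm_subgroup_def using assms(2)
    by (intro generate_subgroup_incl) (auto simp: centralizer_mod_def)
qed

lemma comm_subgroup_mono:
  "A \<subseteq> A' \<Longrightarrow> B \<subseteq> B' \<Longrightarrow> comm_subgroup G A B \<subseteq> comm_subgroup G A' B'"
  unfolding comm_subgroup_def by (intro mono_generate) blast

lemma subgroup_comm_subgroup:
  assumes "A \<subseteq> carrier G" "B \<subseteq> carrier G" shows "subgroup (comm_subgroup G A B) G"
  unfolding comm_subgroup_def using assms by (intro generate_is_subgroup) (auto simp: subset_iff)

lemma comm_subgroup_commute:
  assumes "A \<subseteq> carrier G" "B \<subseteq> carrier G"
  shows "comm_subgroup G A B = comm_subgroup G B A"
proof -
  have "comm_subgroup G C D \<subseteq> comm_subgroup G D C"
    if C: "C \<subseteq> carrier G" and D: "D \<subseteq> carrier G" for C D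
  proof -
    have sub: "subgroup (comm_subgroup G D C) G" using D C by (rule subgroup_comm_subgroup)
    have "commutator c d \<in> comm_subgroup G D C" if "c \<in> C" "d \<in> D" for c d
      by (rule commutator_swap_mem[OF sub _ _ commutator_mem_comm_subgroup]) (use that C D in auto)
    then show ?thesis using C sub by (auto simp: comm_subgroup_subset_iff centralizer_mod_def)
  qed
  then show ?thesis using assms by blast
qed

lemma comm_subgroup_normal:
  assumes A: "A \<lhd> G" and B: "B \<lhd> G"
  shows "comm_subgroup G A B \<lhd> G"
  unfolding comm_subgroup_def
proof (rule normal_generateI)
  interpret A: normal A G by fact
  interpret B: normal B G by fact
  show "{commutator a b | a b. a \<in> A \<and> b \<in> B} \<subseteq> carrier G" by auto
  fix h g assume "h \<in> {commutator a b | a b. a \<in> A \<and> b \<in> B}" and g: "g \<in> carrier G"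
  then obtain a b where h: "h = commutator a b" and a: "a \<in> A" and b: "b \<in> B" by auto
  have "g \<otimes> h \<otimes> inv g = commutator (g \<otimes> a \<otimes> inv g) (g \<otimes> b \<otimes> inv g)"
    using a b g by (simp add: h m_assoc inv_mult_group)
  moreover have "g \<otimes> a \<otimes> inv g \<in> A" "g \<otimes> b \<otimes> inv g \<in> B"
    using a b g by (simp_all add: A.inv_op_closed2 B.inv_op_closed2)
  ultimately show "g \<otimes> h \<otimes> inv g \<in> {commutator a b | a b. a \<in> A \<and> b \<in> B}" by blast
qed

lemma three_subgroups:
  assumes A: "subgroup A G" and B: "subgroup B G" and C: "subgroup C G" and N: "N \<lhd> G"
    and BCA: "comm_subgroup G (comm_subgroup G B C) A \<subseteq> N"
    and CAB: "comm_subgroup G (comm_subgroup G C A) B \<subseteq> N"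
  shows "comm_subgroup G (comm_subgroup G A B) C \<subseteq> N"
proof -
  have AG: "A \<subseteq> carrier G" and BG: "B \<subseteq> carrier G" and CG: "C \<subseteq> carrier G"
    using A B C by (simp_all add: subgroup.subset)
  have "commutator (commutator a b) c \<in> N" if "a \<in> A" "b \<in> B" "c \<in> C" for a b c
  proof (rule double_commutator_mem[OF N])
    show "a \<in> carrier G" "b \<in> carrier G" "c \<in> carrier G" using that AG BG CG by auto
    show "commutator (commutator (inv c) (inv a)) b \<in> N"
      using that A C CAB by (meson commutator_mem_comm_subgroup subgroup.m_inv_closed subsetD)
    show "commutator (commutator (inv b) c) (inv a) \<in> N"
      using that A B BCA by (meson commutator_mem_comm_subgroup subgroup.m_inv_closed subsetD)
  qed
  then have "A \<subseteq> centralizer_mod (centralizer_mod N C) B"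
    using AG BG by (auto simp: centralizer_mod_def subset_iff)
  then have "comm_subgroup G A B \<subseteq> centralizer_mod N C"
    using AG N CG by (simp add: comm_subgroup_subset_iff subgroup_centralizer_mod)
  then show ?thesis
    using subgroup.subset[OF subgroup_comm_subgroup[OF AG BG]] normal_imp_subgroup[OF N]
    by (simp add: comm_subgroup_subset_iff)
qed

lemma lower_central_normal: "lower_central G i \<lhd> G"
  by (induction i) (simp_all add: normal_self comm_subgroup_normal)

lemma subgroup_lower_central: "subgroup (lower_central G i) G"
  using lower_central_normal by (rule normal_imp_subgroup)

lemma lower_central_in_carrier: "lower_central G i \<subseteq> carrier G"
  using subgroup_lower_central by (rule subgroup.subset)

lemma lower_central_Suc_subset_iff:
  assumes "subgroup N G"
  shows "lower_central G (Suc i) \<subseteq> N \<longleftrightarrow> lower_central G i \<subseteq> centralizer_mod N (carrier G)"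
  using assms by (simp add: comm_subgroup_subset_iff lower_central_in_carrier)

lemma lower_central_subset_centralizer_mod:
  "lower_central G i \<subseteq> centralizer_mod (lower_central G (Suc i)) (carrier G)"
  using lower_central_Suc_subset_iff[OF subgroup_lower_central] by blast

lemma lower_central_antimono:
  assumes "i \<le> j" shows "lower_central G j \<subseteq> lower_central G i"
  using _ assms
proof (rule lift_Suc_antimono_le)
  show "lower_central G (Suc n) \<subseteq> lower_central G n" for n
    unfolding lower_central_Suc_subset_iff[OF subgroup_lower_central]
    by (rule normal_subset_centralizer_mod[OF lower_central_normal subset_refl])
qed

lemma lower_central_stationary:
  assumes "lower_central G i \<subseteq> lower_central G (Suc i)"
  shows "lower_central G i \<subseteq> lower_central G (i + j)"
proof (induction j)
  case (Suc j)
  have "lower_central G (Suc i) \<subseteq> lower_central G (Suc (i + j))"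
    unfolding lower_central.simps using Suc.IH by (rule comm_subgroup_mono) simp
  with assms show ?case by simp
qed simp

lemma comm_subgroup_lower_central_subset:
  "comm_subgroup G (lower_central G i) (lower_central G j) \<subseteq> lower_central G (Suc (i + j))"
proof (induction i arbitrary: j)
  case 0
  show ?case by (simp add: comm_subgroup_commute lower_central_in_carrier)
next
  case (Suc i)
  show ?case
    unfolding lower_central.simps(2)[of G i]
  proof (rule three_subgroups)
    have "comm_subgroup G (comm_subgroup G (carrier G) (lower_central G j)) (lower_central G i)
        = comm_subgroup G (lower_central G i) (lower_central G (Suc j))"
      using lower_central_in_carrier[of "Suc j"]
      by (simp add: comm_subgroup_commute lower_central_in_carrier)
    then show "comm_subgroup G (comm_subgroup G (carrier G) (lower_central G j)) (lower_central G i)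
        \<subseteq> lower_central G (Suc (Suc i + j))"
      using Suc.IH[of "Suc j"] by (simp del: lower_central.simps)
    have "comm_subgroup G (comm_subgroup G (lower_central G i) (lower_central G j)) (carrier G)
        \<subseteq> lower_central G (Suc (Suc i + j))"
      using comm_subgroup_mono[OF Suc.IH subset_refl] by simp
    then show "comm_subgroup G (comm_subgroup G (lower_central G j) (lower_central G i)) (carrier G)
        \<subseteq> lower_central G (Suc (Suc i + j))"
      by (simp only: comm_subgroup_commute[of "lower_central G j"] lower_central_in_carrier)
  qed (simp_all only: subgroup_lower_central lower_central_normal subgroup_self)
qed

lemma derived_eq_comm_subgroup: "derived G H = comm_subgroup G H H"
  unfolding derived_def comm_subgroup_def by (rule arg_cong[of _ _ "generate G"]) blast

lemma derived_series_subset_lower_central: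
  "(derived G ^^ d) (carrier G) \<subseteq> lower_central G (2 ^ d - 1)"
proof (induction d)
  case (Suc d)
  let ?L = "lower_central G (2 ^ d - 1)"
  have "(derived G ^^ Suc d) (carrier G) \<subseteq> comm_subgroup G ?L ?L"
    using mono_derived[OF Suc.IH] by (simp only: funpow.simps comp_apply derived_eq_comm_subgroup[of ?L])
  also have "\<dots> \<subseteq> lower_central G (Suc ((2 ^ d - 1) + (2 ^ d - 1)))"
    by (rule comm_subgroup_lower_central_subset)
  also have "Suc ((2 ^ d - 1) + (2 ^ d - 1)) = 2 ^ Suc d - (1 :: nat)"
    unfolding power_Suc using one_le_power[of "2 :: nat" d] by linarith
  finally show ?case .
qed simp

end

section \<open>Nilpotent groups\<close>

locale nilpotent_group = group G for G (structure) +
  assumes ex_lower_central_trivial: "\<exists>c. lower_central G c = {\<one>}"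
begin

lemma lower_central_trivial_iff: "lower_central G i = {\<one>} \<longleftrightarrow> nilpotency_class G \<le> i"
proof
  show "lower_central G i = {\<one>} \<Longrightarrow> nilpotency_class G \<le> i"
    unfolding nilpotency_class_def by (rule Least_le)
  assume "nilpotency_class G \<le> i"
  then have "lower_central G i \<subseteq> lower_central G (nilpotency_class G)"
    by (rule lower_central_antimono)
  also have "\<dots> = {\<one>}"
    unfolding nilpotency_class_def using ex_lower_central_trivial by (rule LeastI_ex)
  finally show "lower_central G i = {\<one>}"
    using subgroup.one_closed[OF subgroup_lower_central] by blast
qed

lemma lower_central_Suc_psubset:
  assumes "i < nilpotency_class G"
  shows "lower_central G (Suc i) \<subset> lower_central G i"
proof -
  have "\<not> lower_central G i \<subseteq> lower_central G (Suc i)"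
  proof
    assume "lower_central G i \<subseteq> lower_central G (Suc i)"
    then have "lower_central G i \<subseteq> lower_central G (i + nilpotency_class G)"
      by (rule lower_central_stationary)
    also have "\<dots> = {\<one>}" by (simp add: lower_central_trivial_iff)
    finally have "lower_central G i = {\<one>}"
      using subgroup.one_closed[OF subgroup_lower_central] by blast
    then show False using assms by (simp add: lower_central_trivial_iff)
  qed
  then show ?thesis using lower_central_antimono[of i "Suc i"] by auto
qed

lemma derived_length_le:
  assumes "nilpotency_class G < 2 ^ d" shows "derived_length G \<le> d"
proof -
  have "lower_central G (2 ^ d - 1) = {\<one>}" using assms by (simp add: lower_central_trivial_iff)
  then have "(derived G ^^ d) (carrier G) = {\<one>}"
    using derived_series_subset_lower_central[of d]
      subgroup.one_closed[OF exp_of_derived_is_subgroup[OF subgroup_self]] by blast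
  then show ?thesis unfolding derived_length_def by (rule Least_le)
qed

lemma two_power_derived_length_le:
  assumes "derived_length G > 0"
  shows "2 ^ derived_length G \<le> 2 * nilpotency_class G"
proof -
  obtain d where d: "derived_length G = Suc d" using assms gr0_conv_Suc by blast
  then have "2 ^ d \<le> nilpotency_class G" using derived_length_le[of d] by fastforce
  then show ?thesis by (simp add: d)
qed

end

lemma (in group) centralizer_mod_subset_normalizer:
  assumes N: "N \<lhd> G" and H: "subgroup H G" and "N \<subseteq> H"
  shows "centralizer_mod N H \<subseteq> normalizer G H"
proof
  have C: "subgroup (centralizer_mod N H) G"
    using N subgroup.subset[OF H] by (rule subgroup_centralizer_mod)
  have conj: "x \<otimes> h \<otimes> inv x \<in> H" if x: "x \<in> centralizer_mod N H" and h: "h \<in> H" for x h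
  proof -
    have "commutator x h \<in> H" using x h \<open>N \<subseteq> H\<close> by (auto simp: centralizer_mod_def)
    then have "commutator x h \<otimes> h \<in> H" using H h by (simp add: subgroup.m_closed)
    then show ?thesis
      using subgroup.mem_carrier[OF C x] subgroup.mem_carrier[OF H h] by (simp add: m_assoc)
  qed
  fix x assume x: "x \<in> centralizer_mod N H"
  have xG: "x \<in> carrier G" using C x by (rule subgroup.mem_carrier)
  have "x <# H #> inv x = H"
  proof
    show "x <# H #> inv x \<subseteq> H" using conj[OF x] by (auto simp: l_coset_def r_coset_def)
    show "H \<subseteq> x <# H #> inv x"
    proof
      fix h assume h: "h \<in> H"
      have "inv x \<otimes> h \<otimes> x \<in> H"
        using conj[OF subgroup.m_inv_closed[OF C x] h] xG by simp
      moreover have "h = x \<otimes> (inv x \<otimes> h \<otimes> x) \<otimes> inv x"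
        using xG subgroup.mem_carrier[OF H h] by (simp add: m_assoc)
      ultimately show "h \<in> x <# H #> inv x" by (auto simp: l_coset_def r_coset_def)
    qed
  qed
  then show "x \<in> normalizer G H"
    using xG subgroup.subset[OF H] by (simp add: normalizer_def stabilizer_def)
qed

lemma (in nilpotent_group) normalizer_neq_self:
  assumes H: "subgroup H G" and "H \<noteq> carrier G"
  shows "normalizer G H \<noteq> H"
proof -
  have "lower_central G (nilpotency_class G) \<subseteq> H"
    using lower_central_trivial_iff[of "nilpotency_class G"] subgroup.one_closed[OF H] by simp
  moreover have "\<not> lower_central G 0 \<subseteq> H" using assms subgroup.subset by auto
  ultimately obtain i where i: "\<not> lower_central G i \<subseteq> H" "lower_central G (Suc i) \<subseteq> H"
    using ex_least_nat_less[of "\<lambda>i. lower_central G i \<subseteq> H"] by blast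
  note lower_central_subset_centralizer_mod
  also note centralizer_mod_antimono[OF subgroup.subset[OF H]]
  also note centralizer_mod_subset_normalizer[OF lower_central_normal H i(2)]
  finally show ?thesis using i(1) by blast
qed

section \<open>Finite p-groups are nilpotent\<close>

lemma (in group_action) prime_dvd_card_orbit:
  assumes p: "Factorial_Ring.prime p" and "card (carrier G) = p ^ k"
    and x: "x \<in> E" and "orbit G \<phi> x \<noteq> {x}"
  shows "p dvd card (orbit G \<phi> x)"
proof -
  have "card (orbit G \<phi> x) dvd p ^ k"
    using orbit_stabilizer_theorem[OF x] assms(2) by (metis dvd_triv_left order_def)
  then obtain i where i: "card (orbit G \<phi> x) = p ^ i"
    using divides_primepow_nat[OF p] by blast
  have "card (orbit G \<phi> x) \<noteq> 1"
    using assms(4) orbit_refl[OF x] by (metis card_1_singletonE singletonD)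
  then show ?thesis using i by (cases i) auto
qed

lemma (in group_action) orbit_eq_singleton_iff:
  assumes x: "x \<in> E" and y: "y \<in> orbit G \<phi> x"
  shows "orbit G \<phi> y = {y} \<longleftrightarrow> orbit G \<phi> x = {x}"
proof
  assume "orbit G \<phi> y = {y}"
  moreover have "y \<in> E" using x y by (auto simp: orbit_def element_image)
  then have "x \<in> orbit G \<phi> y" using y by (intro orbit_sym[OF x])
  ultimately show "orbit G \<phi> x = {x}" by simp
qed (use y in simp)

lemma (in group_action) card_fixed_points_mod:
  assumes p: "Factorial_Ring.prime p" and card_G: "card (carrier G) = p ^ k" and fin: "finite E"
  shows "card E mod p = card {x \<in> E. orbit G \<phi> x = {x}} mod p"
proof -
  let ?moved = "{x \<in> E. orbit G \<phi> x \<noteq> {x}}"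
  have "card ?moved = (\<Sum>x\<in>E. of_bool (orbit G \<phi> x \<noteq> {x}))"
    using fin by (simp add: Int_def)
  also have "\<dots> = (\<Sum>A\<in>orbits G E \<phi>. \<Sum>x\<in>A. of_bool (orbit G \<phi> x \<noteq> {x}))"
    using fin by (rule disjoint_sum[symmetric])
  finally have "card ?moved = \<dots>" .
  moreover have "p dvd (\<Sum>x\<in>A. of_bool (orbit G \<phi> x \<noteq> {x}))" if A: "A \<in> orbits G E \<phi>" for A
  proof -
    obtain y where y: "y \<in> E" "A = orbit G \<phi> y" using A by (auto simp: orbits_def)
    then have "(\<Sum>x\<in>A. of_bool (orbit G \<phi> x \<noteq> {x})) = card A * of_bool (A \<noteq> {y})"
      using orbit_eq_singleton_iff[OF y(1)] by simp
    then show ?thesis using prime_dvd_card_orbit[OF p card_G y(1)] y(2) by simp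
  qed
  ultimately have "p dvd card ?moved" by (simp add: dvd_sum)
  moreover have "card E = card {x \<in> E. orbit G \<phi> x = {x}} + card ?moved"
    using fin by (subst card_Un_disjoint[symmetric]) (auto intro: arg_cong[of _ _ card])
  ultimately show ?thesis by (auto simp: dvd_def)
qed

context group
begin

lemma p_group_nontrivial_center:
  assumes p: "Factorial_Ring.prime p" and G: "p_group p G" and "carrier G \<noteq> {\<one>}"
  obtains z where "z \<in> carrier G" "z \<noteq> \<one>" "\<And>g. g \<in> carrier G \<Longrightarrow> g \<otimes> z = z \<otimes> g"
proof -
  let ?\<phi> = "\<lambda>g. \<lambda>h \<in> carrier G. g \<otimes> h \<otimes> inv g"
  let ?Z = "{z \<in> carrier G. orbit G ?\<phi> z = {z}}"
  interpret conj: group_action G "carrier G" ?\<phi> by (rule action_by_conjugation)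
  obtain k where k: "card (carrier G) = p ^ k" and fin: "finite (carrier G)"
    using G by (auto simp: p_group_def)
  have "card (carrier G) \<noteq> 1" using assms(3) one_closed by (metis card_1_singletonE singletonD)
  then have "p dvd card (carrier G)" using k by (cases k) auto
  then have "p dvd card ?Z"
    using conj.card_fixed_points_mod[OF p k fin] by (simp add: dvd_eq_mod_eq_0)
  moreover have "orbit G ?\<phi> \<one> = {\<one>}" by (auto simp: orbit_def intro: exI[of _ \<one>])
  then have "\<one> \<in> ?Z" by simp
  ultimately have "?Z \<noteq> {\<one>}" using prime_gt_1_nat[OF p] by auto
  then obtain z where z: "z \<in> carrier G" "orbit G ?\<phi> z = {z}" "z \<noteq> \<one>"
    using \<open>\<one> \<in> ?Z\<close> by blast
  have "g \<otimes> z = z \<otimes> g" if g: "g \<in> carrier G" for g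
  proof -
    have "?\<phi> g z \<in> orbit G ?\<phi> z" using g by (auto simp: orbit_def)
    then have "g \<otimes> z \<otimes> inv g = z" using z by simp
    then show ?thesis using g z(1) by (metis inv_solve_right m_closed)
  qed
  then show thesis using that z by blast
qed

lemma p_group_FactGroup:
  assumes p: "Factorial_Ring.prime p" and G: "p_group p G" and K: "K \<lhd> G"
  shows "p_group p (G Mod K)"
proof -
  interpret K: normal K G by fact
  obtain k where k: "card (carrier G) = p ^ k" and fin: "finite (carrier G)"
    using G by (auto simp: p_group_def)
  have "card (carrier (G Mod K)) * card K = p ^ k"
    using lagrange[OF K.subgroup_axioms] k by (simp add: order_def FactGroup_def)
  then have "card (carrier (G Mod K)) dvd p ^ k" by (metis dvd_triv_left)
  then show ?thesis
    using K.factorgroup_is_group fin divides_primepow_nat[OF p]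
    by (auto simp: p_group_def carrier_FactGroup)
qed

lemma p_group_psubset_centralizer_mod:
  assumes p: "Factorial_Ring.prime p" and G: "p_group p G" and K: "K \<lhd> G" and "K \<noteq> carrier G"
  shows "K \<subset> centralizer_mod K (carrier G)"
proof -
  interpret K: normal K G by fact
  interpret Q: group "G Mod K" by (rule K.factorgroup_is_group)
  have "carrier (G Mod K) \<noteq> {K}"
    using \<open>K \<noteq> carrier G\<close> rcos_self[OF _ K.subgroup_axioms] K.subset
    by (auto simp: carrier_FactGroup)
  then obtain z where z: "z \<in> carrier (G Mod K)" "z \<noteq> K"
    and comm: "\<And>g. g \<in> carrier (G Mod K) \<Longrightarrow> g \<otimes>\<^bsub>G Mod K\<^esub> z = z \<otimes>\<^bsub>G Mod K\<^esub> g"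
    using Q.p_group_nontrivial_center[OF p p_group_FactGroup[OF p G K]] by auto
  obtain x where x: "x \<in> carrier G" "z = K #> x" using z(1) by (auto simp: carrier_FactGroup)
  have "commutator x g \<in> K" if g: "g \<in> carrier G" for g
  proof -
    have "K #> (x \<otimes> g) = K #> (g \<otimes> x)"
      using comm[of "K #> g"] x g by (auto simp: carrier_FactGroup K.rcos_sum)
    then have "x \<otimes> g \<in> K #> (g \<otimes> x)"
      using rcos_self[of "x \<otimes> g" K] x g K.subgroup_axioms by auto
    then have "x \<otimes> g \<otimes> inv (g \<otimes> x) \<in> K" using x g by (simp add: K.rcos_module)
    then show ?thesis using x g by (simp add: inv_mult_group m_assoc)
  qed
  then have "x \<in> centralizer_mod K (carrier G)" using x by (simp add: centralizer_mod_def)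
  moreover have "x \<notin> K" using z(2) x K.rcos_const by blast
  ultimately show ?thesis using normal_subset_centralizer_mod[OF K subset_refl] by blast
qed

lemma p_group_ex_lower_central_subset:
  assumes p: "Factorial_Ring.prime p" and G: "p_group p G" and "K \<lhd> G"
  shows "\<exists>i. lower_central G i \<subseteq> K"
  using \<open>K \<lhd> G\<close>
proof (induction "card (carrier G) - card K" arbitrary: K rule: less_induct)
  case less
  let ?C = "centralizer_mod K (carrier G)"
  have fin: "finite (carrier G)" using G by (simp add: p_group_def)
  show ?case
  proof (cases "K = carrier G")
    case True
    then show ?thesis by (intro exI[of _ 0]) simp
  next
    case False
    have "K \<subset> ?C" using p G less.prems False by (rule p_group_psubset_centralizer_mod)
    then have "card K < card ?C" "card ?C \<le> card (carrier G)"
      using fin centralizer_mod_subset by (meson card_mono finite_subset psubset_card_mono)+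
    then have "card (carrier G) - card ?C < card (carrier G) - card K" by simp
    then obtain i where "lower_central G i \<subseteq> ?C"
      using less.hyps normal_centralizer_mod[OF less.prems] by blast
    then show ?thesis
      using lower_central_Suc_subset_iff normal_imp_subgroup[OF less.prems] by blast
  qed
qed

theorem p_group_imp_nilpotent_group:
  assumes "Factorial_Ring.prime p" and "p_group p G"
  shows "nilpotent_group G"
proof
  obtain c where "lower_central G c \<subseteq> {\<one>}"
    using p_group_ex_lower_central_subset[OF assms one_is_normal] by blast
  then show "\<exists>c. lower_central G c = {\<one>}"
    using subgroup.one_closed[OF subgroup_lower_central] by blast
qed

section \<open>Conjugacy classes of subgroups above a normal subgroup\<close>

lemma self_in_subgroup_conj_class:
  assumes "H \<subseteq> carrier G" shows "H \<in> subgroup_conj_class G H"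
proof -
  have "H = \<one> <# H #> inv \<one>" using assms by (simp add: lcos_mult_one)
  then show ?thesis unfolding subgroup_conj_class_def by blast
qed

lemma conj_normal_eq:
  assumes N: "N \<lhd> G" and g: "g \<in> carrier G"
  shows "g <# N #> inv g = N"
proof -
  interpret N: normal N G by fact
  have "g <# N #> inv g = N #> g #> inv g" using N.coset_eq g by simp
  also have "\<dots> = N" using g N.subset by (simp add: coset_mult_assoc)
  finally show ?thesis .
qed

lemma subgroup_conj_class_normal:
  assumes "N \<lhd> G" shows "subgroup_conj_class G N = {N}"
  using conj_normal_eq[OF assms] one_closed by (auto simp: subgroup_conj_class_def)

lemma normal_subset_conjugate:
  assumes "N \<lhd> G" "N \<subseteq> H" "K \<in> subgroup_conj_class G H"
  shows "N \<subseteq> K"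
proof -
  obtain g where g: "g \<in> carrier G" "K = g <# H #> inv g"
    using assms(3) by (auto simp: subgroup_conj_class_def)
  have "g <# N #> inv g \<subseteq> g <# H #> inv g"
    using assms(2) by (auto simp: l_coset_def r_coset_def)
  then show ?thesis using g conj_normal_eq[OF assms(1)] by simp
qed

definition conj_classes_above :: "'a set \<Rightarrow> 'a set set set"
  where "conj_classes_above N =
    subgroup_conj_class G ` {H. subgroup H G \<and> H \<noteq> carrier G \<and> N \<subseteq> H}"

lemma finite_subgroups:
  assumes "finite (carrier G)" shows "finite {H. subgroup H G}"
proof (rule finite_subset)
  show "{H. subgroup H G} \<subseteq> Pow (carrier G)" by (auto dest: subgroup.subset)
qed (simp add: assms)

lemma finite_conj_classes_above:
  assumes "finite (carrier G)" shows "finite (conj_classes_above N)"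
  using finite_subgroups[OF assms] by (simp add: conj_classes_above_def)

lemma conj_classes_above_antimono:
  "M \<subseteq> N \<Longrightarrow> conj_classes_above N \<subseteq> conj_classes_above M"
  unfolding conj_classes_above_def by (intro image_mono) blast

lemma subgroup_conj_class_in_conj_classes_above_iff:
  assumes N: "N \<lhd> G" and H: "subgroup H G"
  shows "subgroup_conj_class G H \<in> conj_classes_above N \<longleftrightarrow> H \<noteq> carrier G \<and> N \<subseteq> H"
proof
  assume "subgroup_conj_class G H \<in> conj_classes_above N"
  then obtain K where K: "subgroup K G" "K \<noteq> carrier G" "N \<subseteq> K"
      "subgroup_conj_class G H = subgroup_conj_class G K"
    by (auto simp: conj_classes_above_def)
  have HK: "H \<in> subgroup_conj_class G K" "K \<in> subgroup_conj_class G H"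
    using self_in_subgroup_conj_class[OF subgroup.subset] H K(1,4) by metis+
  have "N \<subseteq> H" using N K(3) HK(1) by (rule normal_subset_conjugate)
  moreover have "H \<noteq> carrier G"
    using normal_subset_conjugate[OF normal_self _ HK(2)] K(2) subgroup.subset[OF K(1)] by blast
  ultimately show "H \<noteq> carrier G \<and> N \<subseteq> H" by blast
qed (use H in \<open>auto simp: conj_classes_above_def\<close>)

lemma card_conj_classes_above_add_two_le:
  assumes fin: "finite (carrier G)" and M: "M \<lhd> G" and N: "N \<lhd> G" and "N \<subset> M"
    and H: "subgroup H G" and "N \<subset> H" "\<not> M \<subseteq> H"
  shows "card (conj_classes_above M) + 2 \<le> card (conj_classes_above N)"
proof -
  let ?cls = "subgroup_conj_class G"
  have MG: "M \<subseteq> carrier G" and NG: "subgroup N G"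
    using M N normal_imp_subgroup subgroup.subset by blast+
  have "?cls H \<noteq> ?cls N"
    using self_in_subgroup_conj_class[OF subgroup.subset[OF H]] subgroup_conj_class_normal[OF N]
      \<open>N \<subset> H\<close> by blast
  moreover have "?cls N \<notin> conj_classes_above M" "?cls H \<notin> conj_classes_above M"
    using subgroup_conj_class_in_conj_classes_above_iff[OF M] H NG \<open>N \<subset> M\<close> \<open>\<not> M \<subseteq> H\<close> by blast+
  ultimately have "card (conj_classes_above M) + 2
      = card (insert (?cls H) (insert (?cls N) (conj_classes_above M)))"
    using finite_conj_classes_above[OF fin] by simp
  also have "\<dots> \<le> card (conj_classes_above N)"
  proof (rule card_mono[OF finite_conj_classes_above[OF fin]])
    have "?cls N \<in> conj_classes_above N" "?cls H \<in> conj_classes_above N"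
      using subgroup_conj_class_in_conj_classes_above_iff[OF N] H NG assms MG by blast+
    then show "insert (?cls H) (insert (?cls N) (conj_classes_above M)) \<subseteq> conj_classes_above N"
      using conj_classes_above_antimono \<open>N \<subset> M\<close> by blast
  qed
  finally show ?thesis .
qed

lemma proper_subgroups_not_cover:
  assumes H: "subgroup H G" "H \<noteq> carrier G" and K: "subgroup K G" "K \<noteq> carrier G"
  obtains x where "x \<in> carrier G" "x \<notin> H" "x \<notin> K"
proof -
  obtain a b where a: "a \<in> carrier G" "a \<notin> H" and b: "b \<in> carrier G" "b \<notin> K"
    using assms subgroup.subset by blast
  consider (a_uncovered) "a \<notin> K" | (b_uncovered) "b \<notin> H" | (both_covered) "a \<in> K" "b \<in> H"
    by blast
  then show thesis
  proof cases
    case both_covered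
    have "a \<otimes> b \<notin> H"
      using subgroup.m_closed[OF H(1) _ subgroup.m_inv_closed[OF H(1) \<open>b \<in> H\<close>], of "a \<otimes> b"] a b
      by (auto simp: m_assoc)
    moreover have "a \<otimes> b \<notin> K"
      using subgroup.m_closed[OF K(1) subgroup.m_inv_closed[OF K(1) \<open>a \<in> K\<close>], of "a \<otimes> b"] a b
      by auto
    ultimately show thesis using that a b by blast
  qed (use that a b in blast)+
qed

lemma ex_four_proper_subgroups_above:
  assumes N: "subgroup N G"
    and noncyclic: "\<And>x. x \<in> carrier G \<Longrightarrow> generate G (insert x N) \<noteq> carrier G"
  shows "\<exists>\<H> \<subseteq> {H. subgroup H G \<and> H \<noteq> carrier G \<and> N \<subseteq> H}. card \<H> = 4"
proof -
  let ?join = "\<lambda>x. generate G (insert x N)"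
  have join: "x \<in> ?join x" "N \<subseteq> ?join x" for x by (auto intro: generate.incl)
  have sub: "subgroup (?join x) G" if "x \<in> carrier G" for x
    using that subgroup.subset[OF N] by (intro generate_is_subgroup) blast
  have "N \<noteq> carrier G"
    using noncyclic[OF one_closed] join(2)[of \<one>] subgroup.subset[OF sub[OF one_closed]] by blast
  then obtain a where a: "a \<in> carrier G" "a \<notin> N" using subgroup.subset[OF N] by blast
  obtain b where b: "b \<in> carrier G" "b \<notin> ?join a"
    using noncyclic[OF a(1)] subgroup.subset[OF sub[OF a(1)]] by blast
  obtain c where c: "c \<in> carrier G" "c \<notin> ?join a" "c \<notin> ?join b"
    using sub noncyclic a(1) b(1) by (metis proper_subgroups_not_cover)
  have "N \<noteq> ?join a" "N \<noteq> ?join b" "N \<noteq> ?join c"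
      "?join a \<noteq> ?join b" "?join a \<noteq> ?join c" "?join b \<noteq> ?join c"
    using a b c join by blast+
  then have "card {N, ?join a, ?join b, ?join c} = 4" by simp
  moreover have "{N, ?join a, ?join b, ?join c} \<subseteq> {H. subgroup H G \<and> H \<noteq> carrier G \<and> N \<subseteq> H}"
    using N \<open>N \<noteq> carrier G\<close> sub noncyclic join(2) a(1) b(1) c(1) by blast
  ultimately show ?thesis by blast
qed

lemma card_normal_le_card_conj_classes_above:
  assumes fin: "finite (carrier G)"
    and \<H>: "\<H> \<subseteq> {H. H \<lhd> G \<and> H \<noteq> carrier G \<and> N \<subseteq> H}"
  shows "card \<H> \<le> card (conj_classes_above N)"
proof (rule card_inj_on_le)
  show "inj_on (\<lambda>H. {H}) \<H>" by simp
  have "{H} \<in> conj_classes_above N" if "H \<in> \<H>" for H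
    using \<H> that subgroup_conj_class_normal[of H] normal_imp_subgroup[of H G]
    unfolding conj_classes_above_def by (intro image_eqI[of _ _ H]) auto
  then show "(\<lambda>H. {H}) ` \<H> \<subseteq> conj_classes_above N" by blast
qed (rule finite_conj_classes_above[OF fin])

lemma card_conj_classes_above_ge_4:
  assumes fin: "finite (carrier G)" and N: "N \<lhd> G"
    and central: "centralizer_mod N (carrier G) = carrier G"
    and noncyclic: "\<And>x. x \<in> carrier G \<Longrightarrow> generate G (insert x N) \<noteq> carrier G"
  shows "4 \<le> card (conj_classes_above N)"
proof -
  obtain \<H> where \<H>: "card \<H> = 4" "\<H> \<subseteq> {H. subgroup H G \<and> H \<noteq> carrier G \<and> N \<subseteq> H}"
    using ex_four_proper_subgroups_above[OF normal_imp_subgroup[OF N] noncyclic] by blast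
  have "H \<lhd> G" if "subgroup H G" "N \<subseteq> H" for H
    using that subgroup.subset[OF that(1)]
    by (rule normal_if_between_centralizer_mod[where N = N, unfolded central])
  then have "\<H> \<subseteq> {H. H \<lhd> G \<and> H \<noteq> carrier G \<and> N \<subseteq> H}" using \<H>(2) by blast
  then have "card \<H> \<le> card (conj_classes_above N)"
    using fin by (rule card_normal_le_card_conj_classes_above[rotated])
  then show ?thesis by (simp only: \<H>(1))
qed

end

section \<open>Counting conjugacy classes in finite nilpotent groups\<close>

context nilpotent_group
begin

lemma card_conj_classes_above_lower_central:
  assumes fin: "finite (carrier G)" and "Suc i < nilpotency_class G"
  shows "2 * i + 4 \<le> card (conj_classes_above (lower_central G (Suc i)))"
  using assms(2)
proof (induction i)
  case 0
  let ?C = "centralizer_mod (lower_central G 2) (carrier G)"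
  have "\<not> lower_central G 1 \<subseteq> lower_central G 2"
    using lower_central_Suc_psubset[OF 0] by (auto simp: numeral_2_eq_2)
  then have "?C \<noteq> carrier G"
    using lower_central_Suc_subset_iff[OF subgroup_lower_central, of 0 2] by simp
  moreover have "lower_central G 1 \<subseteq> ?C"
    using lower_central_subset_centralizer_mod[of 1] by (simp only: Suc_1)
  ultimately have "generate G (insert x (lower_central G 1)) \<noteq> carrier G"
    if "x \<in> carrier G" for x
    using centralizer_mod_eq_carrier_if_generate[OF lower_central_normal that] by blast
  moreover have "centralizer_mod (lower_central G 1) (carrier G) = carrier G"
    using lower_central_subset_centralizer_mod[of 0] centralizer_mod_subset by auto
  ultimately have "4 \<le> card (conj_classes_above (lower_central G 1))"
    using fin lower_central_normal by (intro card_conj_classes_above_ge_4)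
  then show ?case by simp
next
  case (Suc i)
  let ?M = "lower_central G (Suc i)" and ?N = "lower_central G (Suc (Suc i))"
  let ?P = "lower_central G (Suc (Suc (Suc i)))"
  have "\<not> ?M \<subseteq> centralizer_mod ?P (carrier G)"
    using lower_central_Suc_psubset[OF Suc.prems] lower_central_Suc_subset_iff
      subgroup_lower_central by blast
  then obtain H where H: "subgroup H G" "?N \<subset> H" "\<not> ?M \<subseteq> H"
    using ex_subgroup_psupset_not_supset[OF lower_central_normal lower_central_subset_centralizer_mod]
      lower_central_in_carrier by metis
  have "?N \<subset> ?M" using Suc.prems by (intro lower_central_Suc_psubset) simp
  then have "card (conj_classes_above ?M) + 2 \<le> card (conj_classes_above ?N)"
    using fin lower_central_normal H by (intro card_conj_classes_above_add_two_le)
  with Suc show ?case by simp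
qed

lemma card_conj_classes_above_le_D_count:
  assumes fin: "finite (carrier G)" and N: "\<one> \<in> N" "N \<noteq> {\<one>}"
  shows "card (conj_classes_above N) \<le> D_count G"
proof -
  let ?\<D> = "{subgroup_conj_class G H | H. subgroup H G \<and> H \<noteq> {\<one>} \<and> normalizer G H \<noteq> H}"
  have "finite ?\<D>"
    using finite_subgroups[OF fin] by (rule finite_surj[of _ _ "subgroup_conj_class G"]) blast
  moreover have "conj_classes_above N \<subseteq> ?\<D>"
  proof
    fix \<C> assume "\<C> \<in> conj_classes_above N"
    then obtain H where H: "subgroup H G" "H \<noteq> carrier G" "N \<subseteq> H" "\<C> = subgroup_conj_class G H"
      by (auto simp: conj_classes_above_def)
    have "H \<noteq> {\<one>}" using N H(3) by blast
    then show "\<C> \<in> ?\<D>" using H(1,4) normalizer_neq_self[OF H(1,2)] by blast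
  qed
  ultimately show ?thesis unfolding D_count_def by (rule card_mono)
qed

theorem two_nilpotency_class_le_D_count:
  assumes "finite (carrier G)" and "nilpotency_class G \<ge> 2"
  shows "2 * nilpotency_class G \<le> D_count G"
proof -
  obtain i where i: "nilpotency_class G = Suc (Suc i)"
    using assms(2) by (metis add_2_eq_Suc le_Suc_ex)
  have "2 * nilpotency_class G \<le> card (conj_classes_above (lower_central G (Suc i)))"
    using card_conj_classes_above_lower_central[OF assms(1), of i] i by simp
  also have "\<dots> \<le> D_count G"
  proof (rule card_conj_classes_above_le_D_count[OF assms(1)])
    show "\<one> \<in> lower_central G (Suc i)" using subgroup_lower_central by (rule subgroup.one_closed)
    show "lower_central G (Suc i) \<noteq> {\<one>}" unfolding lower_central_trivial_iff i by simp
  qed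
  finally show ?thesis .
qed

end

theorem mainTheorem5:
  fixes G :: "('a, 'b) monoid_scheme" and p n :: nat
  assumes "Factorial_Ring.prime p" and "n > 1"
    and "p_group p G"
    and "D_count G = n"
  shows "real (nilpotency_class G) \<le> real n / 2
       \<and> real (derived_length G) \<le> log 2 (real n / 2) + 1"
proof -
  have "group G" and fin: "finite (carrier G)" using assms(3) by (simp_all add: p_group_def)
  then interpret nilpotent_group G using assms by (intro group.p_group_imp_nilpotent_group)
  have class_le: "2 * nilpotency_class G \<le> n"
    using two_nilpotency_class_le_D_count[OF fin] assms(2,4)
    by (cases "nilpotency_class G \<ge> 2") auto
  have "2 ^ derived_length G \<le> n"
    using two_power_derived_length_le class_le assms(2) by (cases "derived_length G = 0") auto
  then have "2 ^ derived_length G \<le> real n" by (metis of_nat_le_iff of_nat_numeral of_nat_power)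
  then have "real (derived_length G) \<le> log 2 (real n)" by (simp add: le_log_of_power)
  also have "\<dots> = log 2 (real n / 2) + 1" using assms(2) by (simp add: log_divide)
  finally show ?thesis using class_le by simp
qed

end
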